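(* Let $p$ be an odd prime and let $t\in D_p$. Then modulo $p$: \begin{align*} \sum_{k=0}^{\lfloor p/4\rfloor}C_{2k}t^k&\equiv 2(-1)^{\frac{p-1}{2}}w_{\lfloor p/4\rfloor}(1-32t),\\ \sum_{k=(p-1)/2}^{\lfloor3p/4\rfloor}C_{2k}t^k&\equiv \frac{(-1)^{\frac{p+1}{2}}}{2}\Bigl(w_{\lfloor 3p/4\rfloor}(1-32t)+w_{\lfloor p/4\rfloor}(1-32t)\Bigr),\\ \sum_{k=0}^{\lfloor p/4\rfloor}\binom{4k}{2k} t^k&\equiv \left(\frac{-2}{p}\right) w_{\lfloor p/4\rfloor}(32t-1),\\ \sum_{k=(p+1)/2}^{\lfloor3p/4\rfloor}\binom{4k}{2k} t^k&\equiv \frac{1}{4}\left(\frac{-2}{p}\right)\Bigl(w_{\lfloor 3p/4\rfloor}(32t-1)-w_{\lfloor p/4\rfloor}(32t-1)\Bigr). \end{align*}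
   Context: $C_n=\frac{1}{n+1}\binom{2n}{n}$ are the Catalan numbers. The polynomials $w_n(x)$ are defined by $w_0(x)=1$, $w_1(x)=1+2x$, $w_{n+1}(x)=2xw_n(x)-w_{n-1}(x)$. $D_p$ is the set of rationals whose denominator is not divisible by $p$; congruences between elements of $D_p$ are in the usual sense. $\left(\frac{\cdot}{p}\right)$ is the Legendre symbol. *)

theory Defs
  imports "HOL-Number_Theory.Number_Theory" "HOL-Computational_Algebra.Polynomial"
begin

definition catalan :: "nat \<Rightarrow> rat" where
  "catalan n = 1 / of_nat (n + 1) * of_nat ((2 * n) choose n)"

fun w :: "nat \<Rightarrow> rat poly" where
  "w 0 = 1"
| "w (Suc 0) = [:1, 2:]"
| "w (Suc (Suc n)) = [:0, 2:] * w (Suc n) - w n"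

text \<open>The function \<^const>\<open>quotient_of\<close> returns numerator and denominator in lowest terms,
  with positive denominator.\<close>

definition D :: "nat \<Rightarrow> rat set" where
  "D p = {x. \<not> int p dvd snd (quotient_of x)}"

definition rat_cong :: "rat \<Rightarrow> rat \<Rightarrow> nat \<Rightarrow> bool"  (\<open>(\<open>indent=1\<close>[_ \<equiv>\<^sub>D _] '(mod _'))\<close>) where
  "[x \<equiv>\<^sub>D y] (mod p) \<longleftrightarrow>
     x \<in> D p \<and> y \<in> D p \<and> (\<exists>z \<in> D p. x - y = of_nat p * z)"

end

theory Submission
  imports Defs
begin

text \<open>
  Put \<open>b\<^sub>n(k) = (-64)^k (n + k)! / (n - k)!\<close>. By Pascal's rule,
  \<open>w\<^sub>n(1 - 32t) = \<Sum>\<^sub>k (2n + 1) b\<^sub>n(k) / (2k + 1)! t^k\<close> and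
  \<open>w\<^sub>n(32t - 1) = (-1)^n \<Sum>\<^sub>k b\<^sub>n(k) / (2k)! t^k\<close>. With \<open>a(k) = (4k)! / (2k)!\<close> the left-hand
  sides have coefficients \<open>a(k) / (2k + 1)!\<close> and \<open>a(k) / (2k)!\<close>, so everything is compared term by
  term. The consecutive quotients of \<open>b\<^sub>n\<close> and \<open>a\<close> are
  \<open>-64 (n + 1 + k) (n - k)\<close> and \<open>4 (4k + 1) (4k + 3)\<close>, which are congruent modulo \<open>p\<close> as soon as
  \<open>4n \<equiv> -1\<close> or \<open>4n \<equiv> -3\<close>. This applies to \<open>q = \<lfloor>p/4\<rfloor>\<close> and to \<open>r = \<lfloor>3p/4\<rfloor> = p - 1 - q\<close>. For \<open>k > q\<close>
  the number \<open>a(k)\<close> has acquired the factor \<open>p\<close>, where \<open>b\<^sub>r(k)\<close> has the factor \<open>4p\<close>; hence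
  \<open>b\<^sub>r(k) \<equiv> 4 a(k)\<close> modulo \<open>p\<^sup>2\<close>, which compensates the single \<open>p\<close> in the factorials below.

  In \<open>[a = b] ( mod m)\<close> the space is significant: \<open>(mod\<close> without it is a token of the notation for
  \<^const>\<open>rat_cong\<close>.
\<close>

section \<open>Rationals integral at \<open>p\<close> and their congruences\<close>

text \<open>The reduced denominator divides every other denominator of the same rational, so
  membership can be tested on unreduced fractions.\<close>

lemma mem_D_iff: "x \<in> D p \<longleftrightarrow> (\<exists>a b. \<not> int p dvd b \<and> x = of_int a / of_int b)"
proof
  assume "x \<in> D p"
  then show "\<exists>a b. \<not> int p dvd b \<and> x = of_int a / of_int b"
    using quotient_of_div[of x "fst (quotient_of x)" "snd (quotient_of x)"]
    by (auto simp: D_def)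
next
  assume "\<exists>a b. \<not> int p dvd b \<and> x = of_int a / of_int b"
  then obtain a b where b: "\<not> int p dvd b" and x: "x = of_int a / of_int b" by blast
  obtain m n where mn: "quotient_of x = (m, n)" by force
  have n: "n > 0" "coprime m n" "x = of_int m / of_int n"
    using quotient_of_denom_pos[OF mn] quotient_of_coprime[OF mn] quotient_of_div[OF mn] by auto
  have "b \<noteq> 0" using b by auto
  have "(of_int m :: rat) * of_int b = of_int a * of_int n"
    using x n \<open>b \<noteq> 0\<close> by (simp add: field_simps)
  then have "m * b = a * n" by (metis of_int_eq_iff of_int_mult)
  then have "n dvd b"
    by (metis n(2) coprime_commute coprime_dvd_mult_right_iff dvd_triv_right)
  then show "x \<in> D p" using b mn by (auto simp: D_def dest: dvd_trans)
qed

lemma of_int_in_D: "prime p \<Longrightarrow> of_int a \<in> D p"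
  unfolding mem_D_iff by (rule exI[of _ a], rule exI[of _ 1]) (auto simp: prime_nat_iff)

lemma add_in_D:
  assumes "prime p" "x \<in> D p" "y \<in> D p"
  shows "x + y \<in> D p"
proof -
  obtain a b c d where "\<not> int p dvd b" "x = of_int a / of_int b"
    "\<not> int p dvd d" "y = of_int c / of_int d"
    using assms(2,3) unfolding mem_D_iff by blast
  moreover from this have "b \<noteq> 0" "d \<noteq> 0" by auto
  ultimately have "\<not> int p dvd b * d" "x + y = of_int (a * d + c * b) / of_int (b * d)"
    using assms(1) by (auto simp: prime_dvd_mult_iff field_simps)
  then show ?thesis unfolding mem_D_iff by blast
qed

lemma mult_in_D:
  assumes "prime p" "x \<in> D p" "y \<in> D p"
  shows "x * y \<in> D p"
proof -
  obtain a b c d where "\<not> int p dvd b" "x = of_int a / of_int b"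
    "\<not> int p dvd d" "y = of_int c / of_int d"
    using assms(2,3) unfolding mem_D_iff by blast
  then have "\<not> int p dvd b * d" "x * y = of_int (a * c) / of_int (b * d)"
    using assms(1) by (auto simp: prime_dvd_mult_iff)
  then show ?thesis unfolding mem_D_iff by blast
qed

lemma power_in_D: "prime p \<Longrightarrow> x \<in> D p \<Longrightarrow> x ^ n \<in> D p"
  using of_int_in_D[of p 1] by (induction n) (auto intro: mult_in_D)

lemma rat_cong_add:
  assumes "prime p" "[x \<equiv>\<^sub>D y] (mod p)" "[x' \<equiv>\<^sub>D y'] (mod p)"
  shows "[x + x' \<equiv>\<^sub>D y + y'] (mod p)"
proof -
  obtain z z' where "z \<in> D p" "x - y = of_nat p * z" "z' \<in> D p" "x' - y' = of_nat p * z'"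
    using assms unfolding rat_cong_def by blast
  then have "x + x' - (y + y') = of_nat p * (z + z')" "z + z' \<in> D p"
    by (simp_all add: algebra_simps add_in_D assms(1))
  then show ?thesis using assms unfolding rat_cong_def by (meson add_in_D)
qed

lemma rat_cong_mult_right:
  assumes "prime p" "[x \<equiv>\<^sub>D y] (mod p)" "c \<in> D p"
  shows "[x * c \<equiv>\<^sub>D y * c] (mod p)"
proof -
  obtain z where "z \<in> D p" "x - y = of_nat p * z"
    using assms unfolding rat_cong_def by blast
  then have "x * c - y * c = of_nat p * (z * c)" "z * c \<in> D p"
    by (simp_all add: mult_in_D assms flip: left_diff_distrib mult.assoc)
  then show ?thesis using assms unfolding rat_cong_def by (meson mult_in_D)
qed

text \<open>Reduces the congruences of the theorem to congruences between coefficients of the same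
  power of \<open>t\<close>.\<close>

lemma rat_cong_sum_powers:
  assumes "prime p" "t \<in> D p" "finite S"
    and "\<And>k. k \<in> S \<Longrightarrow> [f k \<equiv>\<^sub>D g k] (mod p)"
  shows "[(\<Sum>k\<in>S. f k * t ^ k) \<equiv>\<^sub>D (\<Sum>k\<in>S. g k * t ^ k)] (mod p)"
  using assms(3,4)
proof (induction S)
  case empty
  have "(0 :: rat) \<in> D p" using of_int_in_D[of p 0] assms(1) by simp
  then show ?case by (auto simp: rat_cong_def)
next
  case (insert k S)
  then show ?case
    using assms(1,2) by (auto intro!: rat_cong_add rat_cong_mult_right power_in_D)
qed

lemma rat_cong_divide:
  assumes "[a = b] ( mod int p)" "\<not> int p dvd d"
  shows "[of_int a / of_int d \<equiv>\<^sub>D of_int b / of_int d] (mod p)"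
proof -
  obtain e where "a - b = int p * e"
    using assms(1) by (auto simp: cong_iff_dvd_diff)
  then have "of_int a / of_int d - of_int b / of_int d = (of_nat p * (of_int e / of_int d) :: rat)"
    by (metis diff_divide_distrib of_int_diff of_int_mult of_int_of_nat_eq times_divide_eq_right)
  moreover have "of_int c / of_int d \<in> D p" for c using assms(2) unfolding mem_D_iff by blast
  ultimately show ?thesis unfolding rat_cong_def by blast
qed

text \<open>If \<open>p\<close> divides \<open>d\<close>, it does so only once; cancelling it turns
  a congruence modulo the square into one modulo \<open>p\<close>. Divisibility of \<open>a\<close>
  keeps the fractions in \<open>D p\<close>.\<close>

lemma rat_cong_divide_square:
  assumes "prime p" "[a = b] ( mod (int p)\<^sup>2)" "int p dvd a" "\<not> (int p)\<^sup>2 dvd d"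
  shows "[of_int a / of_int d \<equiv>\<^sub>D of_int b / of_int d] (mod p)"
proof (cases "int p dvd d")
  case False
  then show ?thesis
    using assms by (intro rat_cong_divide) (auto intro: cong_dvd_modulus)
next
  case True
  have p0: "int p \<noteq> 0" using assms(1) by auto
  obtain d' where d: "d = int p * d'" using True by blast
  obtain a' where a: "a = int p * a'" using assms(3) by blast
  have "int p dvd b"
    using assms(2,3) cong_dvd_iff[of a b "int p"] cong_dvd_modulus[of a b "(int p)\<^sup>2" "int p"] by auto
  then obtain b' where b: "b = int p * b'" by blast
  have "int p * int p dvd int p * (a' - b')"
    using assms(2) a b by (simp add: cong_iff_dvd_diff power2_eq_square right_diff_distrib)
  then have "[a' = b'] ( mod int p)" using p0 by (simp add: cong_iff_dvd_diff)
  moreover have "\<not> int p dvd d'" using assms(4) p0 by (auto simp: d power2_eq_square)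
  ultimately have "[of_int a' / of_int d' \<equiv>\<^sub>D of_int b' / of_int d'] (mod p)"
    by (intro rat_cong_divide)
  then show ?thesis using p0 by (simp add: a b d)
qed

text \<open>The only positive multiple of \<open>p\<close> below \<open>2 * p\<close> is
  \<open>p\<close> itself.\<close>

lemma prime_square_not_dvd_fact:
  assumes "prime p" "n < 2 * p"
  shows "\<not> (int p)\<^sup>2 dvd fact n"
  using assms(2)
proof (induction n)
  case 0
  then show ?case
    using assms(1) by (auto simp: prime_nat_iff zmult_eq_1_iff power2_eq_square)
next
  case (Suc n)
  show ?case
  proof (cases "Suc n = p")
    case True
    have "\<not> p dvd fact n" using assms(1) True by (simp add: prime_dvd_fact_iff)
    then have "\<not> int p dvd fact n" by (metis of_nat_fact of_nat_dvd_iff)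
    then show ?thesis using True by (auto simp: power2_eq_square simp flip: of_nat_Suc)
  next
    case False
    have "\<not> p dvd Suc n"
    proof
      assume "p dvd Suc n"
      then obtain m where m: "Suc n = p * m" by blast
      then have "p * m < p * 2" using Suc.prems by simp
      then have "m < 2" by simp
      moreover have "m \<noteq> 0" using m by (intro notI) simp
      moreover have "m \<noteq> 1" using m False by auto
      ultimately show False by linarith
    qed
    then have "coprime p (Suc n)" using assms(1) by (intro prime_imp_coprime)
    then have "coprime ((int p)\<^sup>2) (int (Suc n))"
      by (simp only: coprime_power_left_iff coprime_int_iff simp_thms)
    then show ?thesis
      using Suc by (auto simp: coprime_dvd_mult_right_iff simp del: of_nat_Suc)
  qed
qed

section \<open>Products with the consecutive quotients of the coefficients\<close>

text \<open>The quotient \<open>(4k)! / (2k)!\<close>.\<close>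

primrec central_num :: "nat \<Rightarrow> int" where
  "central_num 0 = 1"
| "central_num (Suc k) = 4 * (4 * int k + 1) * (4 * int k + 3) * central_num k"

text \<open>The product \<open>(-64)^k (n + k)! / (n - k)!\<close>, which is \<open>0\<close> for \<open>k > n\<close>.\<close>

primrec w_num :: "nat \<Rightarrow> nat \<Rightarrow> int" where
  "w_num n 0 = 1"
| "w_num n (Suc k) = - 64 * (int n + 1 + int k) * (int n - int k) * w_num n k"

lemma central_num_fact: "central_num k * fact (2 * k) = fact (4 * k)"
proof (induction k)
  case (Suc k)
  have e: "2 * Suc k = Suc (Suc (2 * k))" "4 * Suc k = Suc (Suc (Suc (Suc (4 * k))))" by simp_all
  have "fact (4 * Suc k) = (4 * int k + 4) * (4 * int k + 3) * (4 * int k + 2) * (4 * int k + 1) *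
      fact (4 * k)"
    unfolding e fact_Suc by (simp add: algebra_simps)
  also have "\<dots> = central_num (Suc k) * ((2 * int k + 2) * (2 * int k + 1) * fact (2 * k))"
    unfolding Suc.IH[symmetric] by (simp add: algebra_simps)
  also have "(2 * int k + 2) * (2 * int k + 1) * fact (2 * k) = fact (2 * Suc k)"
    unfolding e fact_Suc by (simp add: algebra_simps)
  finally show ?case by simp
qed simp

lemma central_binomial_eq:
  "of_nat ((4 * k) choose (2 * k)) = (of_int (central_num k) / of_int (fact (2 * k)) :: rat)"
proof -
  have "of_nat ((4 * k) choose (2 * k)) = (fact (4 * k) / (fact (2 * k) * fact (2 * k)) :: rat)"
    by (subst binomial_fact) simp_all
  also have "(fact (4 * k) :: rat) = of_int (central_num k) * fact (2 * k)"
    by (metis central_num_fact of_int_fact of_int_mult)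
  finally show ?thesis by simp
qed

lemma catalan_eq: "catalan (2 * k) = of_int (central_num k) / of_int (fact (2 * k + 1))"
  unfolding catalan_def using central_binomial_eq[of k] by simp

lemma w_num_eq_0: "n < k \<Longrightarrow> w_num n k = 0"
proof (induction k)
  case (Suc k)
  then show ?case by (cases "n = k") auto
qed simp

lemma odd_binomial_absorb:
  "(2 * int k + 1) * int ((n + k) choose (2 * k + 1)) = (int n - int k) * int ((n + k) choose (2 * k))"
proof (cases "k \<le> n")
  case True
  have "(2 * k + 1) * ((n + k) choose (2 * k + 1)) = (n - k) * ((n + k) choose (2 * k))"
    using binomial_absorb_comp[of "n + k" "2 * k"] binomial_absorption[of "2 * k" "n + k"] True
    by simp
  then show ?thesis using True
    by (metis (mono_tags, lifting) of_nat_1 of_nat_add of_nat_diff of_nat_mult of_nat_numeral)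
next
  case False
  then show ?thesis by (simp add: binomial_eq_0)
qed

text \<open>The lower index passes from \<open>2 * k\<close> to \<open>2 * k + 1\<close> and then to
  \<open>2 * k + 2\<close>; the two absorption identities supply the two linear factors of
  \<open>w_num\<close>.\<close>

lemma w_num_even: "w_num n k = (-64) ^ k * fact (2 * k) * int ((n + k) choose (2 * k))"
proof (induction k)
  case (Suc k)
  have "int (Suc (Suc (2 * k))) * int (Suc (n + k) choose Suc (Suc (2 * k))) =
      int (Suc (n + k)) * int ((n + k) choose Suc (2 * k))"
    using Suc_times_binomial[of "Suc (2 * k)" "n + k"] by (metis of_nat_mult)
  then have 1: "(2 * int k + 2) * int ((n + Suc k) choose (2 * Suc k)) =
      (int n + 1 + int k) * int ((n + k) choose (2 * k + 1))"
    by (simp add: algebra_simps)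
  have f: "(fact (2 * Suc k) :: int) = (2 * int k + 2) * (2 * int k + 1) * fact (2 * k)"
    by (simp add: algebra_simps)
  have "(-64) ^ Suc k * fact (2 * Suc k) * int ((n + Suc k) choose (2 * Suc k)) =
      (-64) ^ Suc k * fact (2 * k) * (2 * int k + 1) *
      ((2 * int k + 2) * int ((n + Suc k) choose (2 * Suc k)))"
    unfolding f by (simp only: mult_ac)
  also have "\<dots> = (-64) ^ Suc k * fact (2 * k) * (int n + 1 + int k) *
      ((2 * int k + 1) * int ((n + k) choose (2 * k + 1)))"
    unfolding 1 by (simp only: mult_ac)
  also have "\<dots> = w_num n (Suc k)"
    unfolding odd_binomial_absorb w_num.simps Suc.IH by (simp only: power_Suc mult_ac)
  finally show ?case by simp
qed simp

text \<open>Absorption reduces both binomials to \<open>(n + k) choose (2 * k)\<close>, with factors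
  \<open>n - k\<close> and \<open>n + k + 1\<close> that add up to \<open>2 * n + 1\<close>.\<close>

lemma w_num_odd:
  "(2 * int n + 1) * w_num n k =
     (-64) ^ k * fact (2 * k + 1) *
     (int ((n + k) choose (2 * k + 1)) + int ((n + k + 1) choose (2 * k + 1)))"
proof -
  have "int (Suc (2 * k)) * int (Suc (n + k) choose Suc (2 * k)) =
      int (Suc (n + k)) * int ((n + k) choose (2 * k))"
    using Suc_times_binomial[of "2 * k" "n + k"] by (metis of_nat_mult)
  then have 1: "(2 * int k + 1) * int ((n + k + 1) choose (2 * k + 1)) =
      (int n + int k + 1) * int ((n + k) choose (2 * k))"
    by (simp add: algebra_simps)
  have f: "(fact (2 * k + 1) :: int) = (2 * int k + 1) * fact (2 * k)"
    by (simp add: algebra_simps)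
  have "(-64) ^ k * fact (2 * k + 1) *
     (int ((n + k) choose (2 * k + 1)) + int ((n + k + 1) choose (2 * k + 1))) =
     (-64) ^ k * fact (2 * k) * ((2 * int k + 1) * int ((n + k) choose (2 * k + 1)) +
       (2 * int k + 1) * int ((n + k + 1) choose (2 * k + 1)))"
    unfolding f distrib_left[symmetric] by (simp only: mult_ac)
  also have "\<dots> = (2 * int n + 1) * w_num n k"
    unfolding odd_binomial_absorb 1 w_num_even by (simp add: algebra_simps)
  finally show ?thesis by simp
qed

section \<open>Expansion of \<open>w\<close> in powers of \<open>t\<close>\<close>

text \<open>This is the recurrence of \<open>w\<close> read on coefficients: at
  \<open>x = 1 - 32 * t\<close> the multiplier \<open>2 * x\<close> is
  \<open>2 - 64 * t\<close>.\<close>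

lemma sum_second_difference:
  fixes f g h :: "nat \<Rightarrow> rat"
  assumes "h 0 = 2 * g 0 - f 0" "\<And>k. h (Suc k) = 2 * g (Suc k) - f (Suc k) - 64 * g k" "g N = 0"
  shows "(\<Sum>k\<le>N. h k * t ^ k) = (2 - 64 * t) * (\<Sum>k\<le>N. g k * t ^ k) - (\<Sum>k\<le>N. f k * t ^ k)"
proof -
  \<comment> \<open>The induction carries the boundary term of degree \<open>N + 1\<close>, because
    \<open>g N = 0\<close> says nothing about smaller bounds.\<close>
  have "(\<Sum>k\<le>N. h k * t ^ k) =
      (2 - 64 * t) * (\<Sum>k\<le>N. g k * t ^ k) - (\<Sum>k\<le>N. f k * t ^ k) + 64 * t * g N * t ^ N"
    by (induction N) (simp_all add: assms(1,2) algebra_simps)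
  then show ?thesis by (simp add: assms(3))
qed

text \<open>The free bound \<open>N\<close> gives all polynomials in the recurrence one range, and
  later lets \<open>w q\<close> be summed up to \<open>r\<close>. The sign \<open>(-1) ^ n\<close>
  accounts for \<open>2 * (32 * t - 1)\<close> being the negative of
  \<open>2 - 64 * t\<close>.\<close>

lemma poly_w_left:
  assumes "n \<le> N"
  shows "poly (w n) (32 * t - 1) =
    (-1) ^ n * (\<Sum>k\<le>N. of_int (w_num n k) / of_int (fact (2 * k)) * t ^ k)"
proof -
  \<comment> \<open>With the factorials cancelled, the recurrence on coefficients is Pascal's rule
    applied repeatedly.\<close>
  define f :: "nat \<Rightarrow> nat \<Rightarrow> rat" where "f n k = (-64) ^ k * of_nat ((n + k) choose (2 * k))" for n k
  have f: "of_int (w_num n k) / of_int (fact (2 * k)) = f n k" for n k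
    by (simp add: w_num_even f_def)
  have f0: "f n k = 0" if "n < k" for n k
    using that by (simp add: f_def binomial_eq_0 del: binomial_Suc_Suc)
  have "poly (w n) (32 * t - 1) = (-1) ^ n * (\<Sum>k\<le>N. f n k * t ^ k)"
    using assms
  proof (induction n rule: w.induct)
    case 1
    have "(\<Sum>k\<le>N. f 0 k * t ^ k) = (\<Sum>k\<in>{0}. f 0 k * t ^ k)"
      by (rule sum.mono_neutral_right) (auto simp: f0)
    then show ?case by (simp add: f_def)
  next
    case 2
    have "(\<Sum>k\<le>N. f 1 k * t ^ k) = (\<Sum>k\<in>{0, 1}. f 1 k * t ^ k)"
      by (rule sum.mono_neutral_right) (use 2 in \<open>auto simp: f0\<close>)
    then show ?case by (simp add: f_def numeral_eq_Suc)
  next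
    case (3 n)
    have s: "(\<Sum>k\<le>N. f (Suc (Suc n)) k * t ^ k) =
        (2 - 64 * t) * (\<Sum>k\<le>N. f (Suc n) k * t ^ k) - (\<Sum>k\<le>N. f n k * t ^ k)"
    proof (rule sum_second_difference)
      show "f (Suc n) N = 0" using 3 by (simp add: f0)
      fix k
      show "f (Suc (Suc n)) (Suc k) = 2 * f (Suc n) (Suc k) - f n (Suc k) - 64 * f (Suc n) k"
        by (simp add: f_def algebra_simps)
    qed (simp add: f_def)
    show ?case unfolding s using 3 by (simp add: algebra_simps)
  qed
  then show ?thesis by (simp only: f)
qed

lemma poly_w_right:
  assumes "n \<le> N"
  shows "poly (w n) (1 - 32 * t) =
    (\<Sum>k\<le>N. of_int ((2 * int n + 1) * w_num n k) / of_int (fact (2 * k + 1)) * t ^ k)"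
proof -
  define f :: "nat \<Rightarrow> nat \<Rightarrow> rat" where
    "f n k = (-64) ^ k * (of_nat ((n + k) choose (2 * k + 1)) + of_nat ((n + k + 1) choose (2 * k + 1)))"
    for n k
  have f: "of_int ((2 * int n + 1) * w_num n k) / of_int (fact (2 * k + 1)) = f n k" for n k
  proof -
    have "of_int ((2 * int n + 1) * w_num n k) = of_int (fact (2 * k + 1)) * f n k"
      unfolding w_num_odd f_def by (simp only: of_int_mult of_int_add of_int_of_nat_eq of_int_power
          of_int_minus of_int_numeral mult_ac)
    then show ?thesis by simp
  qed
  have f0: "f n k = 0" if "n < k" for n k
    using that by (simp add: f_def binomial_eq_0 del: binomial_Suc_Suc)
  have "poly (w n) (1 - 32 * t) = (\<Sum>k\<le>N. f n k * t ^ k)"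
    using assms
  proof (induction n rule: w.induct)
    case 1
    have "(\<Sum>k\<le>N. f 0 k * t ^ k) = (\<Sum>k\<in>{0}. f 0 k * t ^ k)"
      by (rule sum.mono_neutral_right) (auto simp: f0)
    then show ?case by (simp add: f_def)
  next
    case 2
    have "(\<Sum>k\<le>N. f 1 k * t ^ k) = (\<Sum>k\<in>{0, 1}. f 1 k * t ^ k)"
      by (rule sum.mono_neutral_right) (use 2 in \<open>auto simp: f0\<close>)
    then show ?case by (simp add: f_def numeral_eq_Suc)
  next
    case (3 n)
    have s: "(\<Sum>k\<le>N. f (Suc (Suc n)) k * t ^ k) =
        (2 - 64 * t) * (\<Sum>k\<le>N. f (Suc n) k * t ^ k) - (\<Sum>k\<le>N. f n k * t ^ k)"
    proof (rule sum_second_difference)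
      show "f (Suc n) N = 0" using 3 by (simp add: f0)
      fix k
      show "f (Suc (Suc n)) (Suc k) = 2 * f (Suc n) (Suc k) - f n (Suc k) - 64 * f (Suc n) k"
        by (simp add: f_def algebra_simps)
    qed (simp add: f_def)
    show ?case unfolding s using 3 by (simp add: algebra_simps)
  qed
  then show ?thesis by (simp only: f)
qed

section \<open>Congruences between the two products\<close>

text \<open>The difference of the two sides is \<open>- 4 * (4 * n + 1) * (4 * n + 3)\<close>,
  whatever \<open>k\<close> is.\<close>

lemma w_num_factor_cong:
  assumes "m dvd 4 * int n + 1 \<or> m dvd 4 * int n + 3"
  shows "[- 64 * (int n + 1 + int k) * (int n - int k) = 4 * (4 * int k + 1) * (4 * int k + 3)] ( mod m)"
proof -
  have "m dvd (4 * int n + 1) * (4 * int n + 3) * - 4"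
    using assms by (blast intro: dvd_mult2 dvd_mult)
  also have "\<dots> = - 64 * (int n + 1 + int k) * (int n - int k) - 4 * (4 * int k + 1) * (4 * int k + 3)"
    by (simp add: algebra_simps)
  finally show ?thesis by (simp only: cong_iff_dvd_diff)
qed

lemma w_num_cong_central_num:
  assumes "m dvd 4 * int n + 1 \<or> m dvd 4 * int n + 3"
  shows "[w_num n k = central_num k] ( mod m)"
proof (induction k)
  case (Suc k)
  show ?case
    unfolding w_num.simps central_num.simps by (intro cong_mult w_num_factor_cong assms Suc.IH)
qed simp

text \<open>At \<open>k = q + 1\<close> both products acquire a factor \<open>p\<close>, so their
  congruence modulo \<open>p\<close> at \<open>q\<close> is enough. Afterwards \<open>p\<close>
  divides \<open>central_num k\<close>, and further factors need to agree only modulo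
  \<open>p\<close>.\<close>

lemma w_num_cong_central_num_square:
  fixes p q r :: nat
  assumes "p = 4 * q + 1 \<or> p = 4 * q + 3" "r + q + 1 = p" "q < k"
  shows "int p dvd central_num k \<and> [w_num r k = 4 * central_num k] ( mod (int p)\<^sup>2)"
proof -
  have "4 * int r + 1 = 3 * int p \<or> 4 * int r + 3 = 3 * int p" using assms(1,2) by auto
  then have r: "int p dvd 4 * int r + 1 \<or> int p dvd 4 * int r + 3" by auto
  from \<open>q < k\<close> have "Suc q \<le> k" by simp
  then show ?thesis
  proof (induction k rule: dec_induct)
    case base
    obtain e where e: "w_num r q = central_num q + int p * e"
      using w_num_cong_central_num[OF r, of q] by (metis cong_iff_lin cong_sym)
    consider "p = 4 * q + 1" "r = 3 * q" | "p = 4 * q + 3" "r = 3 * q + 2" using assms by auto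
    then show ?case
    proof cases
      case 1
      then have q: "4 * int q = int p - 1" by simp
      \<comment> \<open>Here \<open>r + 1 + q = p\<close> and \<open>r - q = (p - 1) / 2\<close>.
        The new factor is \<open>32 * p\<close> modulo the square, four times the
        \<open>8 * p\<close> of \<open>cS\<close>.\<close>
      have wS: "w_num r (Suc q) = 4 * (4 * int p) * (2 - 2 * int p) * w_num r q"
        using 1 by (simp add: algebra_simps)
      have cS: "central_num (Suc q) = 4 * int p * (int p + 2) * central_num q"
        unfolding central_num.simps q by simp
      have "w_num r (Suc q) - 4 * central_num (Suc q) =
          (int p)\<^sup>2 * (16 * ((2 - 2 * int p) * e - 3 * central_num q))"
        unfolding wS cS e by (simp add: power2_eq_square algebra_simps)
      moreover have "int p dvd central_num (Suc q)" unfolding cS by simp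
      ultimately show ?thesis by (simp add: cong_iff_dvd_diff del: w_num.simps central_num.simps)
    next
      case 2
      then have q: "4 * int q = int p - 3" by simp
      have wS: "w_num r (Suc q) = 4 * (4 * int p) * (- 2 - 2 * int p) * w_num r q"
        using 2 by (simp add: algebra_simps)
      have cS: "central_num (Suc q) = 4 * int p * (int p - 2) * central_num q"
        unfolding central_num.simps q by simp
      have "w_num r (Suc q) - 4 * central_num (Suc q) =
          (int p)\<^sup>2 * (16 * ((- 2 - 2 * int p) * e - 3 * central_num q))"
        unfolding wS cS e by (simp add: power2_eq_square algebra_simps)
      moreover have "int p dvd central_num (Suc q)" unfolding cS by simp
      ultimately show ?thesis by (simp add: cong_iff_dvd_diff del: w_num.simps central_num.simps)
    qed
  next
    case (step k)
    define x where "x = - 64 * (int r + 1 + int k) * (int r - int k)"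
    define y where "y = 4 * (4 * int k + 1) * (4 * int k + 3)"
    have "int p dvd x - y"
      using w_num_factor_cong[OF r, of k] by (simp add: x_def y_def cong_iff_dvd_diff)
    then have "int p * int p dvd 4 * central_num k * (x - y)"
      using step.IH by (intro mult_dvd_mono) auto
    moreover have "int p * int p dvd (w_num r k - 4 * central_num k) * x"
      using step.IH by (auto simp: cong_iff_dvd_diff power2_eq_square)
    ultimately have "int p * int p dvd
        4 * central_num k * (x - y) + (w_num r k - 4 * central_num k) * x" by (rule dvd_add)
    also have "\<dots> = x * w_num r k - 4 * (y * central_num k)" by (simp add: algebra_simps)
    finally show ?case
      using step.IH by (auto simp: cong_iff_dvd_diff power2_eq_square x_def y_def)
  qed
qed

section \<open>The Legendre symbol of \<open>-2\<close>\<close>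

text \<open>The top \<open>j\<close> factors \<open>p - i\<close> of the factorial are congruent to
  \<open>- i\<close>. Splitting in the middle gives the square of a factorial up to sign.\<close>

lemma fact_pred_cong:
  assumes "j < p"
  shows "[fact (p - 1) = (-1) ^ j * fact j * fact (p - 1 - j)] ( mod int p)"
  using assms
proof (induction j)
  case (Suc j)
  define i where "i = p - 1 - Suc j"
  have i: "p - 1 - j = Suc i" "int p = int i + int j + 2" using Suc.prems by (auto simp: i_def)
  have "(-1) ^ j * fact j * fact (Suc i) - (-1) ^ Suc j * fact (Suc j) * fact i =
      int p * ((-1) ^ j * fact j * fact i)"
    unfolding i fact_Suc by (simp add: algebra_simps)
  then have "[(-1) ^ j * fact j * fact (Suc i) = (-1) ^ Suc j * fact (Suc j) * fact i] ( mod int p)"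
    unfolding cong_iff_dvd_diff by (metis dvd_triv_left)
  moreover have "[fact (p - 1) = (-1) ^ j * fact j * fact (Suc i)] ( mod int p)"
    using Suc i by simp
  ultimately show ?case unfolding i_def by (rule cong_trans[rotated])
qed simp

lemma prime_not_dvd_fact_int: "prime p \<Longrightarrow> n < p \<Longrightarrow> \<not> int p dvd fact n"
  by (metis linorder_not_less of_nat_dvd_iff of_nat_fact prime_dvd_fact_iff)

text \<open>
  The top coefficients of the congruence between \<^const>\<open>w_num\<close> and \<^const>\<open>central_num\<close>
  evaluate \<open>(-64)^q\<close>, hence \<open>(-2)^((p - 1) / 2)\<close>, modulo \<open>p\<close>.
\<close>

lemma Legendre_minus_two:
  fixes p q :: nat
  assumes "prime p" "p = 4 * q + 1 \<or> p = 4 * q + 3"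
  shows "Legendre (-2) (int p) = (-1) ^ q"
proof -
  have p2: "2 < p" using assms prime_gt_1_nat[of p] by auto
  define a :: int where "a = (-64) ^ q"
  define F :: int where "F = fact (2 * q)"
  have "\<not> int p dvd F" unfolding F_def using assms by (intro prime_not_dvd_fact_int) auto
  then have F: "int p dvd F * F * x \<longleftrightarrow> int p dvd x" for x
    using assms(1) by (simp add: prime_dvd_mult_iff)
  have "4 * int q + 1 = int p \<or> 4 * int q + 3 = int p" using assms(2) by auto
  \<comment> \<open>For \<open>k = n = q\<close> the binomial in \<open>w_num_even\<close> is 1, and
    the extra \<open>F\<close> completes \<open>central_num q\<close> to
    \<open>(4 * q)!\<close>.\<close>
  then have "[w_num q q * F = central_num q * F] ( mod int p)"
    by (intro cong_mult w_num_cong_central_num) auto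
  moreover have "w_num q q = a * F"
    using w_num_even[of q q] by (simp add: a_def F_def mult_2)
  ultimately have aF: "int p dvd a * F * F - fact (4 * q)"
    by (simp add: F_def central_num_fact cong_iff_dvd_diff)
  have "\<not> p dvd 2" using p2 by (auto dest: dvd_imp_le)
  then have "[2 ^ (p - 1) = 1] ( mod p)" using assms(1) fermat_theorem by blast
  then have fermat: "[2 ^ (p - 1) = 1] ( mod int p)"
    by (metis cong_int_iff of_nat_1 of_nat_numeral of_nat_power)
  \<comment> \<open>Since \<open>-64 * 4\<close> is minus the square of 16, and
    \<open>2 ^ (p - 1)\<close> is \<open>16 ^ q\<close> or \<open>4 * 16 ^ q\<close>, Fermat's
    theorem will evaluate this.\<close>
  have a4: "a * 4 ^ q = (-1) ^ q * (16 ^ q)\<^sup>2"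
    unfolding a_def by (simp add: power2_eq_square flip: power_mult_distrib)
  have "[(-2) ^ ((p - 1) div 2) = (-1) ^ q] ( mod int p)"
    using assms(2)
  proof
    assume p: "p = 4 * q + 1"
    \<comment> \<open>Now \<open>(p - 1)!\<close> is \<open>(4 * q)!\<close> and splits into equal
      halves, which forces \<open>a\<close> to be 1 modulo \<open>p\<close>.\<close>
    have "p - 1 - 2 * q = 2 * q" using p by simp
    then have "[fact (4 * q) = F * F] ( mod int p)"
      using fact_pred_cong[of "2 * q" p] p by (simp add: F_def)
    then have "int p dvd (a * F * F - fact (4 * q)) + (fact (4 * q) - F * F)"
      using aF unfolding cong_iff_dvd_diff by (intro dvd_add)
    also have "\<dots> = F * F * (a - 1)" by (simp add: algebra_simps)
    finally have a1: "[1 = a] ( mod int p)" using F by (simp add: cong_iff_dvd_diff dvd_diff_commute)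
    have "(2::int) ^ (p - 1) = 16 ^ q" using p by (simp add: power_mult)
    then have "[16 ^ q = 1] ( mod int p)" using fermat by simp
    then have "[(-1) ^ q * (16 ^ q)\<^sup>2 = (-1) ^ q * 1\<^sup>2] ( mod int p)"
      by (intro cong_mult cong_pow) auto
    moreover have "[1 * 4 ^ q = a * 4 ^ q] ( mod int p)" using a1 by (intro cong_mult) auto
    ultimately have "[4 ^ q = (-1) ^ q] ( mod int p)" unfolding a4 by (auto dest: cong_trans)
    moreover have "(-2 :: int) ^ ((p - 1) div 2) = 4 ^ q" using p by (simp add: power_mult)
    ultimately show ?thesis by simp
  next
    assume p: "p = 4 * q + 3"
    have e: "p - 1 - (2 * q + 1) = Suc (2 * q)" "p - 1 = Suc (Suc (4 * q))" "2 * q + 1 = Suc (2 * q)"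
      using p by auto
    \<comment> \<open>The halves are now \<open>(2 * q + 1)!\<close>, with sign \<open>-1\<close>,
      and \<open>(p - 1)!\<close> has two more factors than \<open>(4 * q)!\<close>.\<close>
    have "[fact (p - 1) = (-1) ^ (2 * q + 1) * fact (2 * q + 1) * fact (p - 1 - (2 * q + 1))] ( mod int p)"
      using p by (intro fact_pred_cong) auto
    also have "fact (p - 1) = (4 * int q + 2) * (4 * int q + 1) * fact (4 * q)"
      unfolding e fact_Suc by (simp add: algebra_simps)
    also have "(-1) ^ (2 * q + 1) * fact (2 * q + 1) * fact (p - 1 - (2 * q + 1)) =
        - ((2 * int q + 1) * (2 * int q + 1) * (F * F))"
      unfolding e fact_Suc F_def by (simp add: algebra_simps)
    finally have "int p dvd (4 * int q + 2) * (4 * int q + 1) * fact (4 * q) +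
        (2 * int q + 1) * (2 * int q + 1) * (F * F)"
      by (simp add: cong_iff_dvd_diff)
    moreover have "int p dvd (4 * int q + 2) * (4 * int q + 1) * (a * F * F - fact (4 * q))"
      using aF by (rule dvd_mult)
    ultimately have "int p dvd ((4 * int q + 2) * (4 * int q + 1) * fact (4 * q) +
        (2 * int q + 1) * (2 * int q + 1) * (F * F)) +
        (4 * int q + 2) * (4 * int q + 1) * (a * F * F - fact (4 * q))"
      by (rule dvd_add)
    also have "\<dots> = F * F * ((4 * int q + 2) * (4 * int q + 1) * a + (2 * int q + 1) * (2 * int q + 1))"
      by (simp add: algebra_simps)
    finally have "int p dvd (4 * int q + 2) * (4 * int q + 1) * a + (2 * int q + 1) * (2 * int q + 1)"
      unfolding F .
    \<comment> \<open>As \<open>4 * q\<close> is \<open>-3\<close> modulo \<open>p\<close>, the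
      factor 4 reduces the two summands to \<open>8 * a\<close> and 1.\<close>
    then have "int p dvd 4 * ((4 * int q + 2) * (4 * int q + 1) * a + (2 * int q + 1) * (2 * int q + 1))"
      by (rule dvd_mult)
    also have "\<dots> = (8 * a + 1) + int p * (4 * (int p - 3) * a + (int p - 2))"
      unfolding p by (simp add: algebra_simps)
    finally have "int p dvd 8 * a + 1" by (simp add: dvd_add_left_iff)
    then have "int p dvd 2 * 4 ^ q * (8 * a + 1)" by (rule dvd_mult)
    also have "\<dots> = 16 * (a * 4 ^ q) - - 2 * 4 ^ q" by (simp add: algebra_simps)
    finally have "[16 * (a * 4 ^ q) = - 2 * 4 ^ q] ( mod int p)" unfolding cong_iff_dvd_diff .
    moreover have "16 * (a * 4 ^ q) = (-1) ^ q * (4 * 16 ^ q)\<^sup>2"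
      unfolding a4 by (simp add: power2_eq_square)
    moreover have "(2::int) ^ (p - 1) = 4 * 16 ^ q" unfolding e by (simp add: power_mult)
    then have "[(-1) ^ q * (4 * 16 ^ q)\<^sup>2 = (-1) ^ q * 1\<^sup>2] ( mod int p)"
      using fermat by (intro cong_mult cong_pow) auto
    ultimately have "[- 2 * 4 ^ q = (-1) ^ q] ( mod int p)"
      by (metis cong_sym cong_trans mult.right_neutral one_power2)
    moreover have "(-2 :: int) ^ ((p - 1) div 2) = - 2 * 4 ^ q" using p by (simp add: power_mult)
    ultimately show ?thesis by simp
  qed
  moreover have "[Legendre (-2) (int p) = (-2) ^ ((p - 1) div 2)] ( mod int p)"
    using assms(1) p2 by (rule euler_criterion)
  ultimately have d: "int p dvd Legendre (-2) (int p) - (-1) ^ q"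
    unfolding cong_iff_dvd_diff[symmetric] by (rule cong_trans[rotated])
  \<comment> \<open>Both values lie between \<open>-1\<close> and 1, so they differ by less than
    \<open>p\<close> and the congruence is an equality.\<close>
  have "Legendre (-2) (int p) \<in> {-1, 0, 1}" by (auto simp: Legendre_def)
  moreover have "(-1 :: int) ^ q \<in> {-1, 1}" by (cases "even q") auto
  ultimately have "\<bar>Legendre (-2) (int p) - (-1) ^ q\<bar> < int p" using p2 by auto
  then show ?thesis using d dvd_imp_le_int[OF _ d] by linarith
qed

section \<open>Comparison of coefficients\<close>

text \<open>Padding with zeros matches the range of the polynomial side, whose coefficients below
  \<open>a\<close> must then vanish modulo \<open>p\<close>.\<close>

lemma sum_from_eq:
  fixes t :: rat
  shows "(\<Sum>k = a..r. f k * t ^ k) = (\<Sum>k = 0..r. (if k < a then 0 else f k) * t ^ k)"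
  by (rule sum.mono_neutral_cong_left) auto

theorem theorem3:
  fixes p :: nat and t :: rat
  assumes "prime p" and "odd p" and "t \<in> D p"
  shows "[(\<Sum>k = 0..p div 4. catalan (2 * k) * t ^ k) \<equiv>\<^sub>D
            2 * (-1) ^ ((p - 1) div 2) * poly (w (p div 4)) (1 - 32 * t)] (mod p) \<and>
         [(\<Sum>k = (p - 1) div 2..3 * p div 4. catalan (2 * k) * t ^ k) \<equiv>\<^sub>D
            (-1) ^ ((p + 1) div 2) / 2 *
              (poly (w (3 * p div 4)) (1 - 32 * t) + poly (w (p div 4)) (1 - 32 * t))] (mod p) \<and>
         [(\<Sum>k = 0..p div 4. of_nat ((4 * k) choose (2 * k)) * t ^ k) \<equiv>\<^sub>D
            of_int (Legendre (-2) (int p)) * poly (w (p div 4)) (32 * t - 1)] (mod p) \<and>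
         [(\<Sum>k = (p + 1) div 2..3 * p div 4. of_nat ((4 * k) choose (2 * k)) * t ^ k) \<equiv>\<^sub>D
            1 / 4 * of_int (Legendre (-2) (int p)) *
              (poly (w (3 * p div 4)) (32 * t - 1) - poly (w (p div 4)) (32 * t - 1))] (mod p)"
proof -
  define q where "q = p div 4"
  define r where "r = 3 * p div 4"
  define m where "m = (p - 1) div 2"
  have pq: "p = 4 * q + 1 \<or> p = 4 * q + 3" using \<open>odd p\<close> unfolding q_def by presburger
  have rqp: "r + q + 1 = p" using pq unfolding r_def by auto
  have m: "p = 2 * m + 1" "(p + 1) div 2 = Suc m" using \<open>odd p\<close> by (auto simp: m_def elim!: oddE)
  have p2: "2 < p" using assms(1) \<open>odd p\<close> prime_gt_1_nat[of p] by (cases "p = 2") auto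
  have qm: "q < m" "q \<le> r" and r2p: "2 * r + 1 < 2 * p" using pq rqp m p2 by auto
  have "4 * int q + 1 = int p \<or> 4 * int q + 3 = int p" using pq by auto
  then have mod_q: "[w_num q k = central_num k] ( mod int p)" for k
    by (intro w_num_cong_central_num) auto
  have "4 * int r + 1 = 3 * int p \<or> 4 * int r + 3 = 3 * int p" using pq rqp by auto
  then have mod_r: "[w_num r k = central_num k] ( mod int p)" for k
    by (intro w_num_cong_central_num) auto
  have "coprime (int p) 2" using \<open>odd p\<close> by simp
  then have cop: "coprime (int p) (2 ^ 2)" unfolding coprime_power_right_iff by simp
  \<comment> \<open>The 4 absorbs the factors \<open>1 / 2\<close> and \<open>1 / 4\<close> of the
    claims and matches the 4 in \<open>w_num_cong_central_num_square\<close>.\<close>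
  have not_dvd: "\<not> int p dvd 4 * fact n" if "n < p" for n
    using prime_not_dvd_fact_int[OF assms(1) that] cop by (simp add: coprime_dvd_mult_right_iff)
  have not_dvd2: "\<not> (int p)\<^sup>2 dvd 4 * fact n" if "n < 2 * p" for n
    using prime_square_not_dvd_fact[OF assms(1) that] cop by (simp add: coprime_dvd_mult_right_iff)
  define s :: int where "s = (-1) ^ m"
  \<comment> \<open>Modulo \<open>p\<close>, \<open>2 * s\<close> inverts \<open>2 * q + 1\<close>
    and \<open>- 2 * s\<close> inverts \<open>2 * r + 1\<close>. The errors are exact because the
    second identity is used modulo the square.\<close>
  have s: "2 * s * (2 * int q + 1) = 1 + s * int p" "2 * - s * (2 * int r + 1) = 1 - s * (3 * int p)"
  proof -
    have "(m = 2 * q \<and> p = 4 * q + 1 \<and> r = 3 * q) \<or> (m = 2 * q + 1 \<and> p = 4 * q + 3 \<and> r = 3 * q + 2)"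
      using pq m rqp by auto
    then show "2 * s * (2 * int q + 1) = 1 + s * int p"
      "2 * - s * (2 * int r + 1) = 1 - s * (3 * int p)"
      by (auto simp: s_def)
  qed
  have L: "Legendre (-2) (int p) = (-1) ^ q" using assms(1) pq by (rule Legendre_minus_two)
  \<comment> \<open>Thus \<open>(-1) ^ q\<close> cancels the sign in \<open>poly_w_left\<close> for
    both \<open>q\<close> and \<open>r\<close>.\<close>
  have "even (r + q)" using rqp \<open>odd p\<close> by presburger
  then have Lr: "(-1 :: rat) ^ q * (-1) ^ r = 1" "(-1 :: rat) ^ q * (-1) ^ q = 1"
    by (simp_all add: add.commute flip: power_add)

  have 1: "[(\<Sum>k = 0..q. catalan (2 * k) * t ^ k) \<equiv>\<^sub>D
      2 * (-1) ^ m * poly (w q) (1 - 32 * t)] (mod p)"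
  proof -
    have rhs: "2 * (-1) ^ m * poly (w q) (1 - 32 * t) =
        (\<Sum>k = 0..q. of_int ((2 * s * (2 * int q + 1)) * w_num q k) / of_int (fact (2 * k + 1)) * t ^ k)"
      unfolding poly_w_right[OF order_refl] sum_distrib_left atMost_atLeast0 s_def
      by (rule sum.cong) simp_all
    show ?thesis unfolding rhs
    proof (rule rat_cong_sum_powers[OF assms(1,3)])
      fix k assume "k \<in> {0..q}"
      then have k: "2 * k + 1 < p" using qm m by simp
      have "[1 * central_num k = (2 * s * (2 * int q + 1)) * w_num q k] ( mod int p)"
        unfolding s by (intro cong_mult cong_sym[OF mod_q]) (simp add: cong_iff_dvd_diff)
      then show "[catalan (2 * k) \<equiv>\<^sub>D
          of_int ((2 * s * (2 * int q + 1)) * w_num q k) / of_int (fact (2 * k + 1))] (mod p)"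
        unfolding catalan_eq using k assms(1)
        by (intro rat_cong_divide prime_not_dvd_fact_int) auto
    qed simp
  qed

  have 2: "[(\<Sum>k = m..r. catalan (2 * k) * t ^ k) \<equiv>\<^sub>D
      (-1) ^ Suc m / 2 * (poly (w r) (1 - 32 * t) + poly (w q) (1 - 32 * t))] (mod p)"
  proof -
    define v where "v k = 2 * - s * ((2 * int r + 1) * w_num r k + (2 * int q + 1) * w_num q k)" for k
    have rhs: "(-1) ^ Suc m / 2 * (poly (w r) (1 - 32 * t) + poly (w q) (1 - 32 * t)) =
        (\<Sum>k = 0..r. of_int (v k) / of_int (4 * fact (2 * k + 1)) * t ^ k)"
      unfolding poly_w_right[OF order_refl[of r]] poly_w_right[OF qm(2)] sum_distrib_left
        sum.distrib[symmetric] atMost_atLeast0 v_def s_def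
    proof (rule sum.cong)
      fix k
      have "e / 2 * (x / F * T + y / F * T) = 2 * e * (x + y) / (4 * F) * T" for e x y F T :: rat
        by (simp add: add_divide_distrib algebra_simps)
      then show "(-1) ^ Suc m / 2 * (of_int ((2 * int r + 1) * w_num r k) / of_int (fact (2 * k + 1)) * t ^ k +
          of_int ((2 * int q + 1) * w_num q k) / of_int (fact (2 * k + 1)) * t ^ k) =
        of_int (2 * - ((-1) ^ m) * ((2 * int r + 1) * w_num r k + (2 * int q + 1) * w_num q k)) /
          of_int (4 * fact (2 * k + 1)) * t ^ k"
        by (simp del: fact_Suc)
    qed simp
    show ?thesis unfolding rhs sum_from_eq[where a = m]
    proof (rule rat_cong_sum_powers[OF assms(1,3)])
      fix k assume "k \<in> {0..r}"
      then have k: "2 * k + 1 < 2 * p" using r2p by simp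
      show "[(if k < m then 0 else catalan (2 * k)) \<equiv>\<^sub>D of_int (v k) / of_int (4 * fact (2 * k + 1))] (mod p)"
      proof (cases "k < m")
        case True
        \<comment> \<open>The two contributions cancel, since \<open>2 * r + 1\<close> and
          \<open>2 * q + 1\<close> add up to \<open>2 * p\<close>.\<close>
        have "[v k = 2 * - s * ((2 * int r + 1) * central_num k + (2 * int q + 1) * central_num k)] ( mod int p)"
          unfolding v_def by (intro cong_mult cong_add mod_q mod_r cong_refl)
        also have "2 * - s * ((2 * int r + 1) * central_num k + (2 * int q + 1) * central_num k) =
            int p * (- 4 * s * central_num k)"
          unfolding rqp[symmetric] by (simp add: algebra_simps)
        also have "[int p * (- 4 * s * central_num k) = 0] ( mod int p)" by (simp add: cong_0_iff)
        finally have "[0 = v k] ( mod int p)" by (rule cong_sym)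
        then have "[of_int 0 / of_int (4 * fact (2 * k + 1)) \<equiv>\<^sub>D
            of_int (v k) / of_int (4 * fact (2 * k + 1))] (mod p)"
          using True m by (intro rat_cong_divide not_dvd) auto
        then show ?thesis using True by simp
      next
        case False
        then have "w_num q k = 0" "q < k" using qm by (auto intro: w_num_eq_0)
        then have v: "v k = (1 - s * (3 * int p)) * w_num r k"
          unfolding v_def s(2)[symmetric] by simp
        obtain e f where e: "central_num k = int p * e" and f: "w_num r k = 4 * central_num k + (int p)\<^sup>2 * f"
          using w_num_cong_central_num_square[OF pq rqp \<open>q < k\<close>]
          by (metis cong_iff_lin cong_sym dvdE)
        \<comment> \<open>As \<open>p\<close> divides \<open>central_num k\<close>, the error
          \<open>s * (3 * int p)\<close> contributes only multiples of the square.\<close>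
        have "4 * central_num k - v k = (int p)\<^sup>2 * (12 * s * e - (1 - s * (3 * int p)) * f)"
          unfolding v f e by (simp add: power2_eq_square algebra_simps)
        then have "[4 * central_num k = v k] ( mod (int p)\<^sup>2)" by (simp add: cong_iff_dvd_diff)
        then have "[of_int (4 * central_num k) / of_int (4 * fact (2 * k + 1)) \<equiv>\<^sub>D
            of_int (v k) / of_int (4 * fact (2 * k + 1))] (mod p)"
          using k e by (intro rat_cong_divide_square assms(1) not_dvd2) auto
        then show ?thesis using False by (simp add: catalan_eq)
      qed
    qed simp
  qed

  have 3: "[(\<Sum>k = 0..q. of_nat ((4 * k) choose (2 * k)) * t ^ k) \<equiv>\<^sub>D
      of_int (Legendre (-2) (int p)) * poly (w q) (32 * t - 1)] (mod p)"
  proof -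
    have rhs: "of_int (Legendre (-2) (int p)) * poly (w q) (32 * t - 1) =
        (\<Sum>k = 0..q. of_int (w_num q k) / of_int (fact (2 * k)) * t ^ k)"
      unfolding poly_w_left[OF order_refl] L atMost_atLeast0 using Lr
      by (simp flip: mult.assoc)
    show ?thesis unfolding rhs
    proof (rule rat_cong_sum_powers[OF assms(1,3)])
      fix k assume "k \<in> {0..q}"
      then have "2 * k < p" using qm m by simp
      then show "[of_nat ((4 * k) choose (2 * k)) \<equiv>\<^sub>D of_int (w_num q k) / of_int (fact (2 * k))] (mod p)"
        unfolding central_binomial_eq using mod_q assms(1)
        by (intro rat_cong_divide prime_not_dvd_fact_int) (auto intro: cong_sym)
    qed simp
  qed

  have 4: "[(\<Sum>k = Suc m..r. of_nat ((4 * k) choose (2 * k)) * t ^ k) \<equiv>\<^sub>D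
      1 / 4 * of_int (Legendre (-2) (int p)) *
        (poly (w r) (32 * t - 1) - poly (w q) (32 * t - 1))] (mod p)"
  proof -
    have "1 / 4 * of_int (Legendre (-2) (int p)) * (poly (w r) (32 * t - 1) - poly (w q) (32 * t - 1)) =
        1 / 4 * ((-1) ^ q * poly (w r) (32 * t - 1) - (-1) ^ q * poly (w q) (32 * t - 1))"
      unfolding L by (simp add: algebra_simps)
    also have "\<dots> = 1 / 4 * ((\<Sum>k = 0..r. of_int (w_num r k) / of_int (fact (2 * k)) * t ^ k) -
        (\<Sum>k = 0..r. of_int (w_num q k) / of_int (fact (2 * k)) * t ^ k))"
      unfolding poly_w_left[OF order_refl[of r]] poly_w_left[OF qm(2)] atMost_atLeast0
        mult.assoc[symmetric] Lr by simp
    also have "\<dots> = (\<Sum>k = 0..r. of_int (w_num r k - w_num q k) / of_int (4 * fact (2 * k)) * t ^ k)"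
      unfolding sum_subtractf[symmetric] sum_distrib_left
      by (rule sum.cong) (simp_all add: diff_divide_distrib left_diff_distrib)
    finally have rhs: "1 / 4 * of_int (Legendre (-2) (int p)) *
        (poly (w r) (32 * t - 1) - poly (w q) (32 * t - 1)) = \<dots>" .
    show ?thesis unfolding rhs sum_from_eq[where a = "Suc m"]
    proof (rule rat_cong_sum_powers[OF assms(1,3)])
      fix k assume "k \<in> {0..r}"
      then have k: "2 * k < 2 * p" using r2p by simp
      show "[(if k < Suc m then 0 else of_nat ((4 * k) choose (2 * k))) \<equiv>\<^sub>D
          of_int (w_num r k - w_num q k) / of_int (4 * fact (2 * k))] (mod p)"
      proof (cases "k < Suc m")
        case True
        \<comment> \<open>Here \<open>2 * k\<close> is at most \<open>2 * m = p - 1\<close>, so the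
          denominator is prime to \<open>p\<close>. In the Catalan sum \<open>(2 * k + 1)!\<close>
          contains \<open>p\<close> already at \<open>k = m\<close>, hence the start one index
          earlier there.\<close>
        have "[central_num k - central_num k = w_num r k - w_num q k] ( mod int p)"
          by (intro cong_diff cong_sym[OF mod_q] cong_sym[OF mod_r])
        then have "[of_int 0 / of_int (4 * fact (2 * k)) \<equiv>\<^sub>D
            of_int (w_num r k - w_num q k) / of_int (4 * fact (2 * k))] (mod p)"
          using True m by (intro rat_cong_divide not_dvd) auto
        then show ?thesis using True by simp
      next
        case False
        then have z: "w_num q k = 0" and "q < k" using qm by (auto intro: w_num_eq_0)
        have "[of_int (4 * central_num k) / of_int (4 * fact (2 * k)) \<equiv>\<^sub>D
            of_int (w_num r k - w_num q k) / of_int (4 * fact (2 * k))] (mod p)"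
          using k w_num_cong_central_num_square[OF pq rqp \<open>q < k\<close>] z
          by (intro rat_cong_divide_square assms(1) not_dvd2) (auto intro: cong_sym)
        then show ?thesis using False by (simp add: central_binomial_eq)
      qed
    qed simp
  qed

  show ?thesis
    using 1 2 3 4 unfolding q_def[symmetric] r_def[symmetric] m_def[symmetric] m(2) by blast
qed

end
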